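(* Let $H$ be a Hermitian matrix, $t\in\mathbb{R}$, and let $U=e^{-iHt}$, written in an orthonormal eigenbasis of $H$, so that $U$ is a diagonal unitary matrix. Let $\widetilde U$ be a unitary matrix (an approximation of $U$, such as a product formula for $e^{-iHt}$), written in the same basis and diagonalised as $\widetilde U=VDV^\dagger$ with $V$ unitary and $D$ diagonal unitary. Then for every positive integer $r$, $$\big\|\widetilde U^{\,r}-U^{\,r}\big\|\le 2\,\|V-I\|+r\,\|D-U\| .$$
   Context: $\|\cdot\|$ is the spectral (operator) norm on matrices, $I$ is the identity matrix and $^\dagger$ denotes the conjugate transpose. The difference $D-U$ describes the eigenvalue error of $\widetilde U$ and $V$ describes the basis (eigenvector) error. *)

theory Defs
  imports "HOL-Analysis.Analysis"
begin

definition cadjoint :: "complex^'n^'m \<Rightarrow> complex^'m^'n"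
  where "cadjoint A = (\<chi> i j. cnj (A $ j $ i))"

definition hermitian :: "complex^'n^'n \<Rightarrow> bool"
  where "hermitian A \<longleftrightarrow> cadjoint A = A"

definition unitary :: "complex^'n^'n \<Rightarrow> bool"
  where "unitary A \<longleftrightarrow> cadjoint A ** A = mat 1 \<and> A ** cadjoint A = mat 1"

definition diagonal :: "complex^'n^'n \<Rightarrow> bool"
  where "diagonal A \<longleftrightarrow> (\<forall>i j. i \<noteq> j \<longrightarrow> A $ i $ j = 0)"

text \<open>The norm on vectors is the Euclidean (Hermitian) norm, so this is the largest singular
  value; the norm that the type itself carries is the Frobenius norm.\<close>

definition spectral_norm :: "complex^'n^'m \<Rightarrow> real"
  where "spectral_norm A = onorm ((*v) A)"

definition cscale :: "complex \<Rightarrow> complex^'n^'m \<Rightarrow> complex^'n^'m"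
  where "cscale c A = (\<chi> i j. c * A $ i $ j)"

text \<open>The class operations for multiplication, power and exponential on the vector type act
  componentwise (or do not apply), hence separate matrix versions.\<close>

primrec mpow :: "complex^'n^'n \<Rightarrow> nat \<Rightarrow> complex^'n^'n"
  where
    "mpow A 0 = mat 1"
  | "mpow A (Suc k) = A ** mpow A k"

definition mexp :: "complex^'n^'n \<Rightarrow> complex^'n^'n"
  where "mexp A = (\<Sum>k. (1 / fact k) *\<^sub>R mpow A k)"

text \<open>The columns of \<open>W\<close> form the basis.\<close>

definition orthonormal_eigenbasis :: "complex^'n^'n \<Rightarrow> complex^'n^'n \<Rightarrow> bool"
  where "orthonormal_eigenbasis H W \<longleftrightarrow>
    unitary W \<and> (\<forall>j. \<exists>c. H *v column j W = c *s column j W)"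

text \<open>The matrix, in the basis formed by the columns of the unitary \<open>W\<close>, of the operator that
  \<open>A\<close> describes in the standard basis.\<close>

definition in_basis :: "complex^'n^'n \<Rightarrow> complex^'n^'n \<Rightarrow> complex^'n^'n"
  where "in_basis W A = cadjoint W ** A ** W"

lemma mpow_entry_le:
  fixes A :: "complex^'n^'n"
  defines "c \<equiv> \<Sum>i\<in>UNIV. \<Sum>j\<in>UNIV. norm (A $ i $ j)"
  shows "norm (mpow A k $ i $ j) \<le> c ^ k"
proof (induction k arbitrary: i)
  case 0
  then show ?case by (simp add: mat_def)
next
  case (Suc k)
  have c0: "c \<ge> 0" unfolding c_def by (intro sum_nonneg) simp
  have row: "(\<Sum>l\<in>UNIV. norm (A $ i $ l)) \<le> c"
    unfolding c_def
    by (rule member_le_sum[where f = "\<lambda>i. \<Sum>l\<in>UNIV. norm (A $ i $ l)"]) (auto intro: sum_nonneg)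
  have "norm (mpow A (Suc k) $ i $ j) = norm (\<Sum>l\<in>UNIV. A $ i $ l * mpow A k $ l $ j)"
    by (simp add: matrix_matrix_mult_def)
  also have "\<dots> \<le> (\<Sum>l\<in>UNIV. norm (A $ i $ l) * c ^ k)"
    by (intro sum_norm_le) (auto simp: norm_mult intro: mult_left_mono Suc.IH)
  also have "\<dots> = (\<Sum>l\<in>UNIV. norm (A $ i $ l)) * c ^ k"
    by (simp add: sum_distrib_right)
  also have "\<dots> \<le> c * c ^ k"
    using row c0 by (intro mult_right_mono) auto
  finally show ?case by simp
qed

lemma mexp_summable:
  fixes A :: "complex^'n^'n"
  shows "summable (\<lambda>k. (1 / fact k) *\<^sub>R mpow A k)"
proof -
  define c where "c = (\<Sum>i\<in>UNIV. \<Sum>j\<in>UNIV. norm (A $ i $ j))"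
  define N where "N = real CARD('n)"
  have *: "norm (mpow A k) \<le> N * (N * c ^ k)" for k
  proof -
    have "norm (mpow A k) \<le> (\<Sum>i\<in>(UNIV::'n set). norm (mpow A k $ i))"
      unfolding norm_vec_def by (rule L2_set_le_sum) simp
    also have "\<dots> \<le> (\<Sum>i\<in>(UNIV::'n set). \<Sum>j\<in>(UNIV::'n set). norm (mpow A k $ i $ j))"
    proof (rule sum_mono)
      fix i :: 'n
      show "norm (mpow A k $ i) \<le> (\<Sum>j\<in>UNIV. norm (mpow A k $ i $ j))"
        unfolding norm_vec_def[of "mpow A k $ i"] by (rule L2_set_le_sum) simp
    qed
    also have "\<dots> \<le> (\<Sum>i\<in>(UNIV::'n set). \<Sum>j\<in>(UNIV::'n set). c ^ k)"
      unfolding c_def by (intro sum_mono mpow_entry_le)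
    finally show ?thesis by (simp add: N_def)
  qed
  have "summable (\<lambda>k. (N * N) * (inverse (fact k) * c ^ k))"
    by (intro summable_mult summable_exp)
  then show ?thesis
  proof (rule summable_comparison_test')
    fix k :: nat
    show "norm ((1 / fact k) *\<^sub>R mpow A k) \<le> (N * N) * (inverse (fact k) * c ^ k)"
      using *[of k] by (simp add: divide_simps mult_ac)
  qed
qed

end

theory Submission
  imports Defs
begin

text \<open>Since \<open>(V D V\<^sup>\<dagger>)\<^sup>r = V D\<^sup>r V\<^sup>\<dagger>\<close>, split
  \<open>V D\<^sup>r V\<^sup>\<dagger> - U\<^sup>r = (V - I) D\<^sup>r V\<^sup>\<dagger> + D\<^sup>r (V\<^sup>\<dagger> - I) + (D\<^sup>r - U\<^sup>r)\<close>.
  The first two terms are bounded by \<open>\<parallel>V - I\<parallel>\<close>, as \<open>V\<^sup>\<dagger> - I = V\<^sup>\<dagger> (I - V)\<close>; the last one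
  telescopes, because \<open>U\<close> is diagonal with entries of modulus one.\<close>

section \<open>The spectral norm as an operator norm\<close>

text \<open>\<open>onorm\<close> is taken over real normed spaces, so real linearity is what counts;
  in finite dimension it gives boundedness.\<close>

lemma bounded_linear_matrix_vector_mult:
  fixes A :: "complex^'n^'m"
  shows "bounded_linear ((*v) A)"
proof -
  have "linear ((*v) A)"
    by (rule linearI)
      (simp_all add: vec_eq_iff matrix_vector_mult_def scaleR_sum_right sum.distrib distrib_left)
  then show ?thesis
    by (simp add: linear_conv_bounded_linear)
qed

lemma norm_matrix_vector_le_spectral_norm:
  fixes A :: "complex^'n^'m"
  shows "norm (A *v x) \<le> spectral_norm A * norm x"
  unfolding spectral_norm_def by (intro onorm bounded_linear_matrix_vector_mult)

lemma spectral_norm_leI: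
  fixes A :: "complex^'n^'m"
  assumes "\<And>x. norm (A *v x) \<le> b * norm x"
  shows "spectral_norm A \<le> b"
  unfolding spectral_norm_def using assms by (rule onorm_le)

lemma spectral_norm_nonneg: "0 \<le> spectral_norm (A :: complex^'n^'m)"
  unfolding spectral_norm_def by (intro onorm_pos_le bounded_linear_matrix_vector_mult)

lemma spectral_norm_add_le:
  fixes A B :: "complex^'n^'m"
  shows "spectral_norm (A + B) \<le> spectral_norm A + spectral_norm B"
proof (rule spectral_norm_leI)
  fix x
  have "norm ((A + B) *v x) \<le> norm (A *v x) + norm (B *v x)"
    by (simp add: matrix_vector_mult_add_rdistrib norm_triangle_ineq)
  then show "norm ((A + B) *v x) \<le> (spectral_norm A + spectral_norm B) * norm x"
    using norm_matrix_vector_le_spectral_norm[of A x] norm_matrix_vector_le_spectral_norm[of B x]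
    by (simp add: distrib_right)
qed

text \<open>A change of sign leaves every quotient in the supremum behind \<open>onorm\<close>
  unchanged.\<close>

lemma spectral_norm_minus_commute:
  fixes A B :: "complex^'n^'m"
  shows "spectral_norm (A - B) = spectral_norm (B - A)"
  by (simp add: spectral_norm_def matrix_vector_mult_diff_rdistrib norm_minus_commute onorm_def)

lemma spectral_norm_mult_le:
  fixes A :: "complex^'n^'m" and B :: "complex^'k^'n"
  shows "spectral_norm (A ** B) \<le> spectral_norm A * spectral_norm B"
proof -
  have "(*v) (A ** B) = (*v) A \<circ> (*v) B"
    by (simp add: fun_eq_iff matrix_vector_mul_assoc)
  then show ?thesis
    unfolding spectral_norm_def
    by (simp add: onorm_compose bounded_linear_matrix_vector_mult)
qed

text \<open>This and its left counterpart discard the unitary factors and the powers when products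
  are estimated.\<close>

lemma spectral_norm_mult_contraction_right:
  fixes A :: "complex^'n^'m" and B :: "complex^'k^'n"
  assumes "spectral_norm B \<le> 1"
  shows "spectral_norm (A ** B) \<le> spectral_norm A"
  using spectral_norm_mult_le[of A B] mult_left_mono[OF assms spectral_norm_nonneg[of A]]
  by simp

lemma spectral_norm_mult_contraction_left:
  fixes A :: "complex^'n^'m" and B :: "complex^'k^'n"
  assumes "spectral_norm A \<le> 1"
  shows "spectral_norm (A ** B) \<le> spectral_norm B"
  using spectral_norm_mult_le[of A B] mult_right_mono[OF assms spectral_norm_nonneg[of B]]
  by simp

section \<open>Adjoints and unitary matrices\<close>

text \<open>The real inner product of the type is the real part of the Hermitian one, so moving
  \<open>A\<close> across it produces the conjugate transpose.\<close>

lemma inner_matrix_vector_cadjoint: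
  fixes A :: "complex^'n^'m"
  shows "(A *v x) \<bullet> y = x \<bullet> (cadjoint A *v y)"
proof -
  have *: "(a * b) \<bullet> c = b \<bullet> (cnj a * c)" for a b c :: complex
    by (simp add: inner_complex_def algebra_simps)
  have "(A *v x) \<bullet> y = (\<Sum>i\<in>UNIV. \<Sum>j\<in>UNIV. x $ j \<bullet> (cnj (A $ i $ j) * y $ i))"
    by (simp add: inner_vec_def matrix_vector_mult_def inner_sum_left *)
  also have "\<dots> = (\<Sum>j\<in>UNIV. \<Sum>i\<in>UNIV. x $ j \<bullet> (cnj (A $ i $ j) * y $ i))"
    by (rule sum.swap)
  also have "\<dots> = x \<bullet> (cadjoint A *v y)"
    by (simp add: inner_vec_def matrix_vector_mult_def inner_sum_right cadjoint_def)
  finally show ?thesis .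
qed

lemma spectral_norm_unitary_le:
  assumes "unitary A"
  shows "spectral_norm A \<le> 1"
proof (rule spectral_norm_leI)
  fix x
  have "(A *v x) \<bullet> (A *v x) = x \<bullet> x"
    using assms by (simp add: inner_matrix_vector_cadjoint matrix_vector_mul_assoc unitary_def)
  then show "norm (A *v x) \<le> 1 * norm x"
    by (simp add: norm_eq_sqrt_inner)
qed

lemma cadjoint_cadjoint [simp]: "cadjoint (cadjoint A) = A"
  by (simp add: cadjoint_def vec_eq_iff)

lemma cadjoint_mult: "cadjoint (A ** B) = cadjoint B ** cadjoint A"
  by (simp add: cadjoint_def vec_eq_iff matrix_matrix_mult_def mult.commute)

lemma unitary_cadjoint: "unitary A \<Longrightarrow> unitary (cadjoint A)"
  by (simp add: unitary_def)

section \<open>Powers of contractions\<close>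

lemma spectral_norm_mpow_le:
  assumes "spectral_norm A \<le> 1"
  shows "spectral_norm (mpow A k) \<le> 1"
proof (induction k)
  case 0
  show ?case by (rule spectral_norm_leI) simp
next
  case (Suc k)
  then show ?case
    using spectral_norm_mult_contraction_left[OF assms, of "mpow A k"] by simp
qed

lemma matrix_diff_ldistrib:
  fixes A :: "complex^'n^'m" and B C :: "complex^'k^'n"
  shows "A ** (B - C) = A ** B - A ** C"
  by (simp add: vec_eq_iff matrix_matrix_mult_def algebra_simps sum_subtractf)

lemma matrix_diff_rdistrib:
  fixes A B :: "complex^'n^'m" and C :: "complex^'k^'n"
  shows "(A - B) ** C = A ** C - B ** C"
  by (simp add: vec_eq_iff matrix_matrix_mult_def algebra_simps sum_subtractf)

text \<open>Factors are exchanged one at a time; each exchange costs one \<open>A - B\<close>,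
  surrounded by contractions.\<close>

lemma spectral_norm_mpow_diff_le:
  assumes A: "spectral_norm A \<le> 1" and B: "spectral_norm B \<le> 1"
  shows "spectral_norm (mpow A k - mpow B k) \<le> real k * spectral_norm (A - B)"
proof (induction k)
  case 0
  show ?case by (simp, rule spectral_norm_leI) simp
next
  case (Suc k)
  have "mpow A (Suc k) - mpow B (Suc k) = A ** (mpow A k - mpow B k) + (A - B) ** mpow B k"
    by (simp add: matrix_diff_ldistrib matrix_diff_rdistrib)
  then have "spectral_norm (mpow A (Suc k) - mpow B (Suc k))
      \<le> spectral_norm (A ** (mpow A k - mpow B k)) + spectral_norm ((A - B) ** mpow B k)"
    by (simp only: spectral_norm_add_le)
  also have "\<dots> \<le> spectral_norm (mpow A k - mpow B k) + spectral_norm (A - B)"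
    by (intro add_mono spectral_norm_mult_contraction_left[OF A]
        spectral_norm_mult_contraction_right spectral_norm_mpow_le[OF B])
  also have "\<dots> \<le> real (Suc k) * spectral_norm (A - B)"
    using Suc by (simp add: algebra_simps)
  finally show ?case .
qed

section \<open>Powers and exponentials under a unitary change of basis\<close>

text \<open>Adjacent factors \<open>cadjoint V ** V\<close> cancel. With \<open>cadjoint W\<close>
  for \<open>V\<close> this also covers \<open>in_basis W\<close>.\<close>

lemma mpow_conjugate:
  assumes "cadjoint V ** V = mat 1" "V ** cadjoint V = mat 1"
  shows "mpow (V ** A ** cadjoint V) k = V ** mpow A k ** cadjoint V"
proof (induction k)
  case 0
  then show ?case using assms by simp
next
  case (Suc k)
  have "mpow (V ** A ** cadjoint V) (Suc k)
      = V ** A ** (cadjoint V ** V) ** mpow A k ** cadjoint V"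
    by (simp add: Suc matrix_mul_assoc)
  then show ?case
    using assms by (simp add: matrix_mul_assoc)
qed

lemma in_basis_mpow:
  assumes "unitary W"
  shows "in_basis W (mpow A k) = mpow (in_basis W A) k"
  using mpow_conjugate[of "cadjoint W" A k] assms by (simp add: in_basis_def unitary_def)

lemma in_basis_mexp:
  fixes W A :: "complex^'n^'n"
  assumes "unitary W"
  shows "in_basis W (mexp A) = mexp (in_basis W A)"
proof -
  have scale: "in_basis W (c *\<^sub>R X) = c *\<^sub>R in_basis W X" for c :: real and X
    by (simp add: in_basis_def vec_eq_iff matrix_matrix_mult_def scaleR_sum_right
        sum_distrib_right sum_distrib_left)
  have "linear (in_basis W)"
    by (rule linearI[OF _ scale])
      (simp add: in_basis_def vec_eq_iff matrix_matrix_mult_def sum.distrib algebra_simps)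
  then have "bounded_linear (in_basis W)"
    by (simp add: linear_conv_bounded_linear)
  \<comment> \<open>A bounded linear map passes through the convergent exponential series, which
    leaves the claim for each power.\<close>
  from bounded_linear.suminf[OF this mexp_summable[of A]] show ?thesis
    by (simp add: mexp_def scale in_basis_mpow[OF assms])
qed

lemma in_basis_cscale: "in_basis W (cscale c A) = cscale c (in_basis W A)"
  by (simp add: in_basis_def cscale_def vec_eq_iff matrix_matrix_mult_def
      sum_distrib_right sum_distrib_left mult_ac)

lemma hermitian_in_basis:
  "hermitian H \<Longrightarrow> hermitian (in_basis W H)"
  by (simp add: hermitian_def in_basis_def cadjoint_mult matrix_mul_assoc)

text \<open>Column \<open>j\<close> of \<open>W\<close> is an eigenvector, so column
  \<open>j\<close> of \<open>cadjoint W ** H ** W\<close> is a multiple of column \<open>j\<close>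
  of \<open>cadjoint W ** W = mat 1\<close>.\<close>

lemma diagonal_in_eigenbasis:
  fixes H W :: "complex^'n^'n"
  assumes "orthonormal_eigenbasis H W"
  shows "diagonal (in_basis W H)"
  unfolding diagonal_def
proof (intro allI impI)
  fix i j :: 'n
  assume "i \<noteq> j"
  obtain c where c: "H *v column j W = c *s column j W"
    using assms by (auto simp: orthonormal_eigenbasis_def)
  have entry: "(A ** W) $ i $ j = (A *v column j W) $ i" for A :: "complex^'n^'n"
    by (simp add: matrix_matrix_mult_def matrix_vector_mult_def column_def)
  have "in_basis W H $ i $ j = (cadjoint W *v (H *v column j W)) $ i"
    by (simp add: in_basis_def entry matrix_vector_mul_assoc)
  also have "\<dots> = c * (cadjoint W ** W) $ i $ j"
    by (simp add: c entry vector_scalar_commute)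
  also have "\<dots> = 0"
    using assms \<open>i \<noteq> j\<close> by (simp add: orthonormal_eigenbasis_def unitary_def mat_def)
  finally show "in_basis W H $ i $ j = 0" .
qed

section \<open>Diagonal matrices and the evolution operator\<close>

lemma sum_diagonal_row:
  fixes A :: "complex^'n^'n"
  assumes "diagonal A"
  shows "(\<Sum>l\<in>UNIV. A $ i $ l * f l) = A $ i $ i * f i"
proof -
  have "(\<Sum>l\<in>UNIV. A $ i $ l * f l) = (\<Sum>l\<in>{i}. A $ i $ l * f l)"
    using assms by (intro sum.mono_neutral_right) (auto simp: diagonal_def)
  then show ?thesis by simp
qed

lemma mpow_diagonal_entry:
  fixes A :: "complex^'n^'n"
  assumes "diagonal A"
  shows "mpow A k $ i $ j = (if i = j then (A $ i $ i) ^ k else 0)"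
proof (induction k)
  case 0
  then show ?case by (simp add: mat_def)
next
  case (Suc k)
  then show ?case
    by (simp add: matrix_matrix_mult_def sum_diagonal_row[OF assms])
qed

text \<open>Reading off an entry is bounded linear, so the series can be summed entry by entry; on
  the diagonal it is the scalar exponential series.\<close>

lemma mexp_diagonal_entry:
  fixes A :: "complex^'n^'n"
  assumes "diagonal A"
  shows "mexp A $ i $ j = (if i = j then exp (A $ i $ i) else 0)"
proof -
  have "bounded_linear (\<lambda>X::complex^'n^'n. X $ i $ j)"
    by (intro bounded_linear_compose[OF bounded_linear_vec_nth] bounded_linear_vec_nth)
  from bounded_linear.suminf[OF this mexp_summable[of A]] show ?thesis
    by (simp add: mexp_def mpow_diagonal_entry[OF assms] exp_def inverse_eq_divide)
qed

lemma spectral_norm_diagonal_le: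
  fixes A :: "complex^'n^'n"
  assumes "diagonal A" "\<And>i. norm (A $ i $ i) \<le> 1"
  shows "spectral_norm A \<le> 1"
proof (rule spectral_norm_leI)
  fix x :: "complex^'n"
  have "norm ((A *v x) $ i) \<le> norm (x $ i)" for i
  proof -
    have "(A *v x) $ i = A $ i $ i * x $ i"
      by (simp add: matrix_vector_mult_def sum_diagonal_row[OF assms(1)])
    then show ?thesis
      using mult_right_mono[OF assms(2)[of i], of "norm (x $ i)"] by (simp add: norm_mult)
  qed
  then show "norm (A *v x) \<le> 1 * norm x"
    by (simp add: norm_le_componentwise_cart)
qed

text \<open>In the eigenbasis the evolution is the exponential of a diagonal matrix with purely
  imaginary entries, hence diagonal with entries of modulus one.\<close>

lemma spectral_norm_evolution_le:
  fixes H W :: "complex^'n^'n"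
  assumes H: "hermitian H" and W: "orthonormal_eigenbasis H W"
  shows "spectral_norm (in_basis W (mexp (cscale (- \<i> * complex_of_real t) H))) \<le> 1"
proof -
  define L where "L = in_basis W H"
  define A where "A = cscale (- \<i> * complex_of_real t) L"
  have eq: "in_basis W (mexp (cscale (- \<i> * complex_of_real t) H)) = mexp A"
    using W by (simp add: A_def L_def in_basis_mexp in_basis_cscale orthonormal_eigenbasis_def)
  have "diagonal L"
    unfolding L_def by (rule diagonal_in_eigenbasis[OF W])
  then have A: "diagonal A"
    by (simp add: A_def diagonal_def cscale_def)
  have "hermitian L"
    unfolding L_def by (rule hermitian_in_basis[OF H])
  then have "cnj (L $ i $ i) = L $ i $ i" for i
    by (simp add: hermitian_def cadjoint_def vec_eq_iff)
  then have "Im (L $ i $ i) = 0" for i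
    by (metis Reals_cnj_iff complex_is_Real_iff)
  \<comment> \<open>The modulus of the exponential is \<open>exp (Re (A $ i $ i))\<close>, and this
    real part is \<open>t * Im (L $ i $ i) = 0\<close>.\<close>
  then have "norm (exp (A $ i $ i)) = 1" for i
    by (simp add: A_def cscale_def norm_exp_eq_Re)
  then show ?thesis
    unfolding eq using A
    by (intro spectral_norm_diagonal_le) (simp_all add: diagonal_def mexp_diagonal_entry)
qed

section \<open>Eigenvector and eigenvalue errors combined\<close>

theorem mainTheorem2:
  fixes H W S U Ut V D :: "complex^'n^'n"
    and t :: real
    and r :: nat
  assumes "hermitian H"
    and "orthonormal_eigenbasis H W"
    and "U = in_basis W (mexp (cscale (- \<i> * complex_of_real t) H))"
    and "unitary S"
    and "Ut = in_basis W S"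
    and "unitary V"
    and "diagonal D"
    and "unitary D"
    and "Ut = V ** D ** cadjoint V"
    and "r > 0"
  shows "spectral_norm (mpow Ut r - mpow U r)
           \<le> 2 * spectral_norm (V - mat 1) + real r * spectral_norm (D - U)"
proof -
  have U: "spectral_norm U \<le> 1"
    using assms(1-3) by (simp only: spectral_norm_evolution_le)
  have D: "spectral_norm D \<le> 1"
    using assms(8) by (rule spectral_norm_unitary_le)
  have Dr: "spectral_norm (mpow D r) \<le> 1"
    using D by (rule spectral_norm_mpow_le)
  have Va: "spectral_norm (cadjoint V) \<le> 1"
    by (intro spectral_norm_unitary_le unitary_cadjoint assms(6))
  have "mpow Ut r = V ** mpow D r ** cadjoint V"
    using assms(6,9) by (simp add: mpow_conjugate unitary_def)
  \<comment> \<open>The cross terms \<open>mpow D r ** cadjoint V\<close> and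
    \<open>mpow D r\<close> are added and subtracted.\<close>
  then have split: "mpow Ut r - mpow U r
      = ((V - mat 1) ** mpow D r ** cadjoint V + mpow D r ** (cadjoint V - mat 1))
        + (mpow D r - mpow U r)"
    by (simp add: matrix_diff_ldistrib matrix_diff_rdistrib)
  have first: "spectral_norm ((V - mat 1) ** mpow D r ** cadjoint V) \<le> spectral_norm (V - mat 1)"
    using spectral_norm_mult_contraction_right[OF Va, of "(V - mat 1) ** mpow D r"]
      spectral_norm_mult_contraction_right[OF Dr, of "V - mat 1"] by simp
  have "cadjoint V - mat 1 = cadjoint V ** (mat 1 - V)"
    using assms(6) by (simp add: matrix_diff_ldistrib unitary_def)
  then have "spectral_norm (cadjoint V - mat 1) \<le> spectral_norm (V - mat 1)"
    using spectral_norm_mult_contraction_left[OF Va, of "mat 1 - V"]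
    by (simp add: spectral_norm_minus_commute)
  then have second: "spectral_norm (mpow D r ** (cadjoint V - mat 1)) \<le> spectral_norm (V - mat 1)"
    using spectral_norm_mult_contraction_left[OF Dr, of "cadjoint V - mat 1"] by simp
  \<comment> \<open>The basis error enters once for \<open>V\<close> and once for
    \<open>cadjoint V\<close>, whence the factor 2. It does not grow with \<open>r\<close>, since
    conjugation by \<open>V\<close> survives only at the two ends of the power.\<close>
  show ?thesis
    unfolding split
    using spectral_norm_add_le[of "(V - mat 1) ** mpow D r ** cadjoint V
          + mpow D r ** (cadjoint V - mat 1)" "mpow D r - mpow U r"]
      spectral_norm_add_le[of "(V - mat 1) ** mpow D r ** cadjoint V"
        "mpow D r ** (cadjoint V - mat 1)"]
      first second spectral_norm_mpow_diff_le[OF D U, of r]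
    by linarith
qed

end
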